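(* Let $\mu$ be an $s_0$-dimensional Ahlfors-David probability measure on $\mathbb{R}^q$ ($s_0>0$) and let $r\in(0,\infty)$. For every $n\geq 1$, let $\alpha_n\in C_{n,r}(\mu)$ be an arbitrary $n$-optimal set for $\mu$ of order $r$ and let $\{P_a(\alpha_n)\}_{a\in\alpha_n}$ be an arbitrary Voronoi partition with respect to $\alpha_n$. Write $\underline{J}(\alpha_n,\mu):=\min_{a\in\alpha_n}I_a(\alpha_n,\mu)$ and $\overline{J}(\alpha_n,\mu):=\max_{a\in\alpha_n}I_a(\alpha_n,\mu)$. Then \[ \underline{J}(\alpha_n,\mu)\asymp\frac{1}{n}e^r_{n,r}(\mu),\qquad \overline{J}(\alpha_n,\mu)\asymp\frac{1}{n}e^r_{n,r}(\mu),\qquad e^r_{n,r}(\mu)-e^r_{n+1,r}(\mu)\asymp \frac{1}{n}e^r_{n,r}(\mu). \]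
   Context: Let $|\cdot|$ be a norm on $\mathbb{R}^q$ ($q\ge1$) and $d$ the metric induced by it; $B(x,\epsilon):=\{y\in\mathbb{R}^q:d(y,x)\leq\epsilon\}$. A Borel probability measure $\mu$ on $\mathbb{R}^q$ is $s_0$-dimensional Ahlfors-David (regular) if there are constants $C_1,C_2,\epsilon_0>0$ such that $C_1\epsilon^{s_0}\leq\mu(B(x,\epsilon))\leq C_2\epsilon^{s_0}$ for all $\epsilon\in(0,\epsilon_0)$ and all $x\in{\rm supp}(\mu)$. For $n\ge 1$ let $\mathcal{D}_n:=\{\alpha\subset\mathbb{R}^q:1\leq{\rm card}(\alpha)\leq n\}$. For a Borel probability measure $\nu$ and $r\in(0,\infty)$, the $n$th quantization error of order $r$ is $e_{n,r}(\nu):=\big(\inf_{\alpha\in\mathcal{D}_n}\int d(x,\alpha)^r d\nu(x)\big)^{1/r}$, and $e^r_{n,r}(\nu):=(e_{n,r}(\nu))^r$. A set $\alpha\in\mathcal{D}_n$ attaining the infimum is called an $n$-optimal set for $\nu$ of order $r$; $C_{n,r}(\nu)$ is the set of all of them. For a finite set $\alpha\subset\mathbb{R}^q$, a Voronoi partition with respect to $\alpha$ is a partition $\{P_a(\alpha):a\in\alpha\}$ of $\mathbb{R}^q$ into Borel sets with $\{x:d(x,a)<d(x,\alpha\setminus\{a\})\}\subset P_a(\alpha)\subset\{x:d(x,a)=d(x,\alpha)\}$ for every $a\in\alpha$ (with $d(x,\emptyset)=+\infty$). For such a partition, $I_a(\alpha,\nu):=\int_{P_a(\alpha)}d(x,\alpha)^r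 d\nu(x)$, $a\in\alpha$. For sequences of positive reals, $a_n\asymp b_n$ means there is a constant $C>0$ independent of $n$ such that $Cb_n\leq a_n\leq C^{-1}b_n$ for all $n\geq 1$. *)

theory Defs
  imports "HOL-Probability.Probability"
begin

text \<open>
  The norm on the ambient space is an arbitrary one, passed explicitly as a function
  \<open>N\<close>; it need not be the Euclidean \<^const>\<open>norm\<close>. All norms on a finite-dimensional space
  induce the same topology, so \<^const>\<open>open\<close>, \<^const>\<open>closed\<close> and \<^const>\<open>borel\<close> of the type
  are also those of \<open>N\<close>.
\<close>

definition is_norm :: "('a::real_vector \<Rightarrow> real) \<Rightarrow> bool" where
  "is_norm N \<longleftrightarrow>
     (\<forall>x. 0 \<le> N x) \<and>
     (\<forall>x. N x = 0 \<longleftrightarrow> x = 0) \<and>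
     (\<forall>c x. N (c *\<^sub>R x) = \<bar>c\<bar> * N x) \<and>
     (\<forall>x y. N (x + y) \<le> N x + N y)"

definition ndist :: "('a::real_vector \<Rightarrow> real) \<Rightarrow> 'a \<Rightarrow> 'a \<Rightarrow> real" where
  "ndist N x y = N (x - y)"

definition nball :: "('a::real_vector \<Rightarrow> real) \<Rightarrow> 'a \<Rightarrow> real \<Rightarrow> 'a set" where
  "nball N x \<epsilon> = {y. ndist N y x \<le> \<epsilon>}"

text \<open>Extended-real valued, so that the distance to the empty set is \<open>\<infinity>\<close>.\<close>

definition nsetdist :: "('a::real_vector \<Rightarrow> real) \<Rightarrow> 'a \<Rightarrow> 'a set \<Rightarrow> ereal" where
  "nsetdist N x A = (INF a\<in>A. ereal (ndist N x a))"

definition borel_prob :: "'a::topological_space measure \<Rightarrow> bool" where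
  "borel_prob \<mu> \<longleftrightarrow> prob_space \<mu> \<and> sets \<mu> = sets borel"

definition supp :: "'a::topological_space measure \<Rightarrow> 'a set" where
  "supp \<mu> = {x. \<forall>U. open U \<and> x \<in> U \<longrightarrow> emeasure \<mu> U > 0}"

definition ahlfors_david ::
    "('a::{real_vector,topological_space} \<Rightarrow> real) \<Rightarrow> real \<Rightarrow> 'a measure \<Rightarrow> bool" where
  "ahlfors_david N s \<mu> \<longleftrightarrow>
     (\<exists>C1>0. \<exists>C2>0. \<exists>\<epsilon>0>0. \<forall>\<epsilon>\<in>{0<..<\<epsilon>0}. \<forall>x\<in>supp \<mu>.
        C1 * \<epsilon> powr s \<le> measure \<mu> (nball N x \<epsilon>) \<and>
        measure \<mu> (nball N x \<epsilon>) \<le> C2 * \<epsilon> powr s)"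

definition codebooks :: "nat \<Rightarrow> 'a set set" where
  "codebooks n = {\<alpha>. finite \<alpha> \<and> 1 \<le> card \<alpha> \<and> card \<alpha> \<le> n}"

text \<open>
  The distortion \<open>\<integral> d(x, \<alpha>)\<^sup>r d\<nu>(x)\<close>. The conversion \<^const>\<open>real_of_ereal\<close> loses nothing
  for nonempty \<open>\<alpha>\<close>, the only case in which it is used.
\<close>

definition distortion ::
    "('a::real_vector \<Rightarrow> real) \<Rightarrow> real \<Rightarrow> 'a measure \<Rightarrow> 'a set \<Rightarrow> ennreal" where
  "distortion N r \<nu> \<alpha> = (\<integral>\<^sup>+ x. ennreal (real_of_ereal (nsetdist N x \<alpha>) powr r) \<partial>\<nu>)"

text \<open>
  As a real number, the quantization error takes the junk value \<open>0\<close> when every distortion is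
  infinite. This does not happen for Ahlfors-David probability measures, whose support is
  bounded; the same applies to \<open>cell_error\<close> below.
\<close>

definition quant_error ::
    "('a::real_vector \<Rightarrow> real) \<Rightarrow> nat \<Rightarrow> real \<Rightarrow> 'a measure \<Rightarrow> real" where
  "quant_error N n r \<nu> = enn2real (INF \<alpha>\<in>codebooks n. distortion N r \<nu> \<alpha>) powr (1 / r)"

definition optimal_sets ::
    "('a::real_vector \<Rightarrow> real) \<Rightarrow> nat \<Rightarrow> real \<Rightarrow> 'a measure \<Rightarrow> 'a set set" where
  "optimal_sets N n r \<nu> =
     {\<alpha>\<in>codebooks n. distortion N r \<nu> \<alpha> = (INF \<beta>\<in>codebooks n. distortion N r \<nu> \<beta>)}"

definition voronoi_partition ::
    "('a::{real_vector,topological_space} \<Rightarrow> real) \<Rightarrow> 'a set \<Rightarrow> ('a \<Rightarrow> 'a set) \<Rightarrow> bool" where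
  "voronoi_partition N \<alpha> P \<longleftrightarrow>
     (\<forall>a\<in>\<alpha>. P a \<in> sets borel) \<and>
     disjoint_family_on P \<alpha> \<and>
     (\<Union>a\<in>\<alpha>. P a) = UNIV \<and>
     (\<forall>a\<in>\<alpha>. {x. ereal (ndist N x a) < nsetdist N x (\<alpha> - {a})} \<subseteq> P a \<and>
            P a \<subseteq> {x. ereal (ndist N x a) = nsetdist N x \<alpha>})"

text \<open>\<open>I\<^sub>a(\<alpha>, \<nu>)\<close> for the cells \<open>P\<close> of a Voronoi partition.\<close>

definition cell_error ::
    "('a::real_vector \<Rightarrow> real) \<Rightarrow> real \<Rightarrow> 'a measure \<Rightarrow> 'a set \<Rightarrow> ('a \<Rightarrow> 'a set) \<Rightarrow> 'a \<Rightarrow> real" where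
  "cell_error N r \<nu> \<alpha> P a =
     enn2real (\<integral>\<^sup>+ x\<in>P a. ennreal (real_of_ereal (nsetdist N x \<alpha>) powr r) \<partial>\<nu>)"

definition J_lower ::
    "('a::real_vector \<Rightarrow> real) \<Rightarrow> real \<Rightarrow> 'a measure \<Rightarrow> 'a set \<Rightarrow> ('a \<Rightarrow> 'a set) \<Rightarrow> real" where
  "J_lower N r \<nu> \<alpha> P = Min (cell_error N r \<nu> \<alpha> P ` \<alpha>)"

definition J_upper ::
    "('a::real_vector \<Rightarrow> real) \<Rightarrow> real \<Rightarrow> 'a measure \<Rightarrow> 'a set \<Rightarrow> ('a \<Rightarrow> 'a set) \<Rightarrow> real" where
  "J_upper N r \<nu> \<alpha> P = Max (cell_error N r \<nu> \<alpha> P ` \<alpha>)"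

text \<open>
  The relation \<open>a\<^sub>n \<asymp> b\<^sub>n\<close> is between sequences of positive reals, hence the positivity clauses.
  It concerns all indices \<open>n \<ge> 1\<close>, not just large ones as with \<open>\<Theta>\<close>.
\<close>

definition comparable :: "(nat \<Rightarrow> real) \<Rightarrow> (nat \<Rightarrow> real) \<Rightarrow> bool" where
  "comparable a b \<longleftrightarrow>
     (\<forall>n\<ge>1. 0 < a n \<and> 0 < b n) \<and>
     (\<exists>C>0. \<forall>n\<ge>1. C * b n \<le> a n \<and> a n \<le> inverse C * b n)"

end

theory Submission
  imports Defs
begin

text \<open>
  Both sides of each comparison have the exact order \<open>n powr (-1 - r/s)\<close>. Write \<open>\<rho>\<^sub>n = n powr (-1/s)\<close>, \<open>K = supp \<mu>\<close> and \<open>V \<alpha> = \<integral> d(x, \<alpha>)\<^sup>r d\<mu>\<close>.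
  The orders in question are \<open>\<rho>\<^sub>n\<^sup>r\<close> for the \<open>n\<close>th error and \<open>\<rho>\<^sub>n\<^sup>r / n\<close> for the cell errors and
  for the decrements.

  The engine is a comparison of an optimal set \<open>\<alpha>\<close> with the set obtained by exchanging one of its
  points \<open>a\<close> for a point \<open>x\<close> of \<open>K\<close> (\<open>optimal_exchange\<close>). If \<open>x\<close> has distance at least \<open>h\<close> from
  \<open>\<alpha>\<close>, then \<open>x\<close> saves a multiple of \<open>h\<^sup>r \<mu>(B(x, h/4))\<close>. If each point of \<open>K\<close> in the cell of \<open>a\<close>
  has another point of \<open>\<alpha>\<close> within distance \<open>G\<close>, then deleting \<open>a\<close> costs at most
  \<open>G\<^sup>r \<mu>(P a)\<close>. Optimality says that the saving does not exceed the cost. The required neighbours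
  exist whenever the cell is light (\<open>neighbour\<close>): if a point \<open>y\<close> of \<open>K\<close> had no other codebook
  point nearby, then a whole ball around \<open>y\<close>, hence too much mass, would lie in the cell of \<open>a\<close>.

  There are always points of \<open>K\<close> at distance at least a multiple of \<open>\<rho>\<^sub>n\<close> from a set of \<open>n\<close> points, since balls
  of radius a small multiple of \<open>\<rho>\<^sub>n\<close> around these carry at most half of the mass (\<open>gap_prob\<close>). This bounds the
  error and the decrement from below.

  The central upper bound is \<open>optimal_covering\<close>: an \<open>n\<close>-optimal set is within \<open>O(\<rho>\<^sub>n)\<close> of
  every point of \<open>K\<close>. Let \<open>D\<close> be the supremum over \<open>K\<close> of the distance to \<open>\<alpha>\<close>. Some cell has mass
  at most \<open>1/n\<close>; if \<open>D\<close> is large compared with \<open>\<rho>\<^sub>n\<close> its points have neighbours within \<open>2D\<close>, so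
  its deletion costs at most \<open>(2D)\<^sup>r / n\<close>, while a point at distance \<open>D/2\<close> saves a multiple of
  \<open>D powr (r + s)\<close>. Hence \<open>D powr s = O(1/n)\<close>.

  The rest follows from the covering bound. The part of a cell in \<open>K\<close> lies in a ball of
  radius \<open>O(\<rho>\<^sub>n)\<close>, which bounds the cell errors from above. The exchange
  inequality with \<open>G = O(\<rho>\<^sub>n)\<close> and \<open>h\<close> of order \<open>\<rho>\<^sub>n\<close> shows
  that every cell has mass at least a multiple of \<open>1/n\<close>; as mass cannot concentrate near \<open>a\<close>, this
  bounds the cell errors from below. Deleting from an \<open>(n + 1)\<close>-optimal set a point whose cell
  has mass at most \<open>1 / (n + 1)\<close> bounds the decrement from above.
\<close>

section \<open>Distance to a codebook\<close>

text \<open>The real form of \<^const>\<open>nsetdist\<close>, which suits nonempty finite sets.\<close>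

definition codist :: "('a::real_vector \<Rightarrow> real) \<Rightarrow> 'a set \<Rightarrow> 'a \<Rightarrow> real" where
  "codist N \<alpha> y = Min ((\<lambda>a. N (y - a)) ` \<alpha>)"

lemma codist_le: "finite \<alpha> \<Longrightarrow> a \<in> \<alpha> \<Longrightarrow> codist N \<alpha> y \<le> N (y - a)"
  unfolding codist_def by (intro Min_le) auto

lemma codist_attained:
  assumes "finite \<alpha>" "\<alpha> \<noteq> {}"
  obtains a where "a \<in> \<alpha>" "codist N \<alpha> y = N (y - a)"
proof -
  have "codist N \<alpha> y \<in> (\<lambda>a. N (y - a)) ` \<alpha>"
    unfolding codist_def using assms by (intro Min_in) auto
  then show thesis using that by auto
qed

lemma nsetdist_eq_codist:
  assumes "finite \<alpha>" "\<alpha> \<noteq> {}"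
  shows "nsetdist N y \<alpha> = ereal (codist N \<alpha> y)"
proof -
  obtain a where a: "a \<in> \<alpha>" "codist N \<alpha> y = N (y - a)"
    using codist_attained[OF assms] .
  show ?thesis
    unfolding nsetdist_def ndist_def
  proof (rule antisym)
    show "(INF b\<in>\<alpha>. ereal (N (y - b))) \<le> ereal (codist N \<alpha> y)"
      using a by (metis INF_lower)
    show "ereal (codist N \<alpha> y) \<le> (INF b\<in>\<alpha>. ereal (N (y - b)))"
      using codist_le[OF assms(1)] by (intro INF_greatest) auto
  qed
qed

lemma borel_probD:
  assumes "borel_prob \<mu>"
  shows "prob_space \<mu>" "sets \<mu> = sets borel" "space \<mu> = UNIV"
  using assms sets_eq_imp_space_eq[of \<mu> borel] unfolding borel_prob_def by auto

text \<open>
  The complement of the support is a union of open null sets, of which countably many suffice by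
  the Lindelof property.
\<close>

lemma AE_in_supp:
  fixes \<mu> :: "'a::second_countable_topology measure"
  assumes "sets \<mu> = sets borel"
  shows "AE x in \<mu>. x \<in> supp \<mu>"
proof -
  define \<U> where "\<U> = {U. open U \<and> emeasure \<mu> U = 0}"
  obtain \<V> where \<V>: "\<V> \<subseteq> \<U>" "countable \<V>" "\<Union>\<V> = \<Union>\<U>"
    using Lindelof[of \<U>] unfolding \<U>_def by auto
  have "(\<Union>U\<in>\<V>. U) \<in> null_sets \<mu>"
  proof (rule null_sets_UN'[OF \<V>(2)])
    fix U assume "U \<in> \<V>"
    then have "open U" "emeasure \<mu> U = 0" using \<V>(1) unfolding \<U>_def by auto
    then show "U \<in> null_sets \<mu>" using assms by (simp add: null_sets_def)
  qed
  moreover have "- supp \<mu> \<subseteq> \<Union>\<V>"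
    unfolding \<V>(3) supp_def \<U>_def by auto
  ultimately show ?thesis
    by (intro AE_I'[of "\<Union>\<V>"]) (simp, blast)
qed

locale normed =
  fixes N :: "'a::euclidean_space \<Rightarrow> real"
  assumes norm: "is_norm N"
begin

lemma N_nonneg [simp]: "0 \<le> N x"
  and N_scale: "N (t *\<^sub>R x) = \<bar>t\<bar> * N x"
  and N_triangle: "N (x + y) \<le> N x + N y"
  using norm unfolding is_norm_def by auto

lemma N_commute: "N (x - y) = N (y - x)"
  using N_scale[of "-1" "x - y"] by simp

lemma N_triangle3: "N (x - z) \<le> N (x - y) + N (y - z)"
  using N_triangle[of "x - y" "y - z"] by simp

lemma N_continuous: "continuous_on UNIV N"
proof (rule convex_on_continuous)
  show "convex_on UNIV N"
  proof (rule convex_onI)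
    fix t :: real and x y :: 'a
    assume "0 < t" "t < 1"
    then show "N ((1 - t) *\<^sub>R x + t *\<^sub>R y) \<le> (1 - t) * N x + t * N y"
      using N_triangle[of "(1 - t) *\<^sub>R x" "t *\<^sub>R y"] by (simp add: N_scale)
  qed simp
qed simp

lemma N_measurable [measurable]: "N \<in> borel_measurable borel"
  using N_continuous by (rule borel_measurable_continuous_onI)

lemma nball_iff: "y \<in> nball N x t \<longleftrightarrow> N (y - x) \<le> t"
  by (simp add: nball_def ndist_def)

lemma nball_measurable [measurable]: "nball N x t \<in> sets borel"
proof -
  have "nball N x t = {y \<in> space borel. N (y - x) \<le> t}"
    by (auto simp: nball_iff)
  also have "\<dots> \<in> sets borel" by measurable
  finally show ?thesis .
qed

lemma codist_measurable [measurable]: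
  assumes "finite \<alpha>"
  shows "codist N \<alpha> \<in> borel_measurable borel"
proof -
  have "(\<lambda>y. Min ((\<lambda>a. N (y - a)) ` \<alpha>)) \<in> borel_measurable borel"
    by (intro borel_measurable_Min assms) measurable
  then show ?thesis unfolding codist_def .
qed

lemma codist_nonneg:
  assumes "finite \<alpha>" "\<alpha> \<noteq> {}"
  shows "0 \<le> codist N \<alpha> y"
  by (metis N_nonneg assms codist_attained)

lemma codist_triangle:
  assumes "finite \<alpha>" "\<alpha> \<noteq> {}"
  shows "codist N \<alpha> x \<le> N (x - y) + codist N \<alpha> y"
proof -
  obtain a where a: "a \<in> \<alpha>" "codist N \<alpha> y = N (y - a)"
    using codist_attained[OF assms] .
  then show ?thesis
    using codist_le[OF assms(1), of a N x] N_triangle3[of x a y] by simp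
qed

lemma codist_le_codist:
  assumes "finite \<alpha>" "a \<in> \<alpha>" "codist N \<beta> y = N (y - a)"
  shows "codist N \<alpha> y \<le> codist N \<beta> y"
  using codist_le[OF assms(1,2), of N y] assms(3) by simp

end

section \<open>Regularity at all scales\<close>

text \<open>
  Regularity is only given for small radii and for centres in the support. Here it is stated for
  all radii, with the lower bound truncated at the total mass, and the upper bound holds for
  arbitrary centres, in particular for codebook points outside the support.
\<close>

locale ahlfors_quantization = normed N + prob_space \<mu>
  for N :: "'a::euclidean_space \<Rightarrow> real" and \<mu> :: "'a measure" +
  fixes s r c C R :: real
  assumes sets_eq [measurable_cong]: "sets \<mu> = sets borel"
    and s_pos: "0 < s" and r_pos: "0 < r"
    and c_pos: "0 < c" and C_pos: "0 < C" and R_pos: "0 < R"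
    and ball_lower: "\<And>x t. x \<in> supp \<mu> \<Longrightarrow> 0 < t \<Longrightarrow> min 1 (c * t powr s) \<le> measure \<mu> (nball N x t)"
    and ball_upper: "\<And>x t. 0 < t \<Longrightarrow> measure \<mu> (nball N x t) \<le> C * t powr s"
    and supp_diam: "\<And>x y. x \<in> supp \<mu> \<Longrightarrow> y \<in> supp \<mu> \<Longrightarrow> N (x - y) \<le> R"

text \<open>
  The support is bounded by tightness: a large ball has mass greater than \<open>1 - \<delta>\<close>, where \<open>\<delta>\<close> is a
  lower bound for the mass of the balls of radius \<open>t0\<close> around support points, so each of these
  meets the large ball. Beyond the diameter a ball around a support point has full mass, and
  between \<open>\<epsilon>0\<close> and the diameter the bounds persist with worse constants. A ball that meets the
  support is contained in a ball of twice the radius around a support point.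
\<close>

lemma ahlfors_quantizationI:
  fixes N :: "'a::euclidean_space \<Rightarrow> real"
  assumes "is_norm N" "borel_prob \<mu>" "0 < s" "0 < r" "ahlfors_david N s \<mu>"
  obtains c C R where "ahlfors_quantization N \<mu> s r c C R"
proof -
  interpret normed N by standard fact
  interpret prob_space \<mu> using borel_probD[OF assms(2)] by simp
  note sets_eq [measurable_cong] = borel_probD(2)[OF assms(2)]
  note space_eq = borel_probD(3)[OF assms(2)]
  note AE_supp = AE_in_supp[OF sets_eq]
  obtain C1 C2 \<epsilon>0 where pos: "C1 > 0" "C2 > 0" "\<epsilon>0 > 0" and
    reg: "\<And>t x. 0 < t \<Longrightarrow> t < \<epsilon>0 \<Longrightarrow> x \<in> supp \<mu> \<Longrightarrow>
       C1 * t powr s \<le> prob (nball N x t) \<and> prob (nball N x t) \<le> C2 * t powr s"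
    using assms(5) unfolding ahlfors_david_def by (metis greaterThanLessThan_iff)
  have ball_sets [measurable]: "nball N x t \<in> sets \<mu>" for x t by (simp add: sets_eq)
  define t0 where "t0 = \<epsilon>0 / 2"
  have t0: "0 < t0" "t0 < \<epsilon>0" using pos unfolding t0_def by auto
  define \<delta> where "\<delta> = C1 * t0 powr s"
  have \<delta>: "0 < \<delta>" using pos t0 unfolding \<delta>_def by auto
  obtain z where z: "z \<in> supp \<mu>"
    using AE_supp AE_const by (metis (mono_tags, lifting) eventually_mono)
  have "(\<lambda>k. prob (nball N z (real k))) \<longlonglongrightarrow> prob (\<Union>k. nball N z (real k))"
    by (intro finite_Lim_measure_incseq) (auto simp: incseq_def nball_iff subset_eq)
  moreover have "(\<Union>k. nball N z (real k)) = space \<mu>"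
    using real_arch_simple by (auto simp: space_eq nball_iff)
  ultimately have "(\<lambda>k. prob (nball N z (real k))) \<longlonglongrightarrow> 1"
    by (simp add: prob_space)
  then have "eventually (\<lambda>k. prob (nball N z (real k)) > 1 - \<delta>) sequentially"
    using \<delta> by (intro order_tendstoD(1)) auto
  then obtain k where k: "prob (nball N z (real k)) > 1 - \<delta>"
    by (auto simp: eventually_sequentially)
  have near: "N (x - z) \<le> real k + t0" if x: "x \<in> supp \<mu>" for x
  proof (rule ccontr)
    assume far: "\<not> N (x - z) \<le> real k + t0"
    have "nball N z (real k) \<inter> nball N x t0 = {}"
    proof (rule ccontr)
      assume "nball N z (real k) \<inter> nball N x t0 \<noteq> {}"
      then obtain y where "N (y - z) \<le> real k" "N (y - x) \<le> t0" by (auto simp: nball_iff)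
      then show False using far N_triangle3[of x z y] N_commute[of x y] by simp
    qed
    then have "prob (nball N z (real k)) + prob (nball N x t0)
        = prob (nball N z (real k) \<union> nball N x t0)"
      by (simp add: finite_measure_Union)
    also have "\<dots> \<le> 1" by simp
    finally show False using k reg[OF t0 x] unfolding \<delta>_def by simp
  qed
  define R where "R = 2 * (real k + t0)"
  have R: "0 < R" using t0 unfolding R_def by simp
  have diam: "N (x - y) \<le> R" if "x \<in> supp \<mu>" "y \<in> supp \<mu>" for x y
    using near[OF that(1)] near[OF that(2)] N_triangle3[of x y z] N_commute[of y z]
    unfolding R_def by simp
  define C' where "C' = max C2 (\<epsilon>0 powr (-s))"
  have C': "0 < C'" using pos unfolding C'_def by simp
  have upper_supp: "prob (nball N x t) \<le> C' * t powr s" if "x \<in> supp \<mu>" "0 < t" for x t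
  proof (cases "t < \<epsilon>0")
    case True
    then have "prob (nball N x t) \<le> C2 * t powr s" using reg that by blast
    also have "\<dots> \<le> C' * t powr s" unfolding C'_def by (intro mult_right_mono) auto
    finally show ?thesis .
  next
    case False
    have "prob (nball N x t) \<le> \<epsilon>0 powr (-s) * \<epsilon>0 powr s"
      using pos by (simp flip: powr_add)
    also have "\<dots> \<le> C' * t powr s"
      unfolding C'_def using False pos assms(3) by (intro mult_mono powr_mono2) auto
    finally show ?thesis .
  qed
  define C where "C = C' * 2 powr s"
  have C: "0 < C" using C' unfolding C_def by simp
  have upper: "prob (nball N x t) \<le> C * t powr s" if t: "0 < t" for x t
  proof (cases "nball N x t \<inter> supp \<mu> = {}")
    case True
    then have "AE y in \<mu>. y \<notin> nball N x t" using AE_supp by (auto elim!: eventually_mono)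
    then have "prob (nball N x t) = 0"
      by (subst prob_eq_0) auto
    then show ?thesis using C by simp
  next
    case False
    then obtain y where y: "N (y - x) \<le> t" "y \<in> supp \<mu>" by (auto simp: nball_iff)
    have "nball N x t \<subseteq> nball N y (2 * t)"
    proof
      fix u assume "u \<in> nball N x t"
      then show "u \<in> nball N y (2 * t)"
        using y(1) N_triangle3[of u y x] N_commute[of x y] by (simp add: nball_iff)
    qed
    then have "prob (nball N x t) \<le> prob (nball N y (2 * t))" by (intro finite_measure_mono) auto
    also have "\<dots> \<le> C' * (2 * t) powr s" using y t by (intro upper_supp) auto
    also have "\<dots> = C * t powr s" using t by (simp add: C_def powr_mult)
    finally show ?thesis .
  qed
  define c where "c = min C1 (\<delta> / R powr s)"
  have c: "0 < c" using pos \<delta> R unfolding c_def by simp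
  have lower: "min 1 (c * t powr s) \<le> prob (nball N x t)" if x: "x \<in> supp \<mu>" and t: "0 < t" for x t
  proof -
    consider "t < \<epsilon>0" | "\<epsilon>0 \<le> t" "t < R" | "R \<le> t" by linarith
    then show ?thesis
    proof cases
      case 1
      have "c * t powr s \<le> C1 * t powr s" unfolding c_def by (intro mult_right_mono) auto
      also have "\<dots> \<le> prob (nball N x t)" using reg[OF t 1 x] by simp
      finally show ?thesis by simp
    next
      case 2
      have "c * t powr s \<le> (\<delta> / R powr s) * R powr s"
        unfolding c_def using 2 t \<delta> assms(3) by (intro mult_mono powr_mono2) auto
      also have "\<dots> = \<delta>" using R by simp
      also have "\<dots> \<le> prob (nball N x t0)" using reg[OF t0 x] unfolding \<delta>_def by simp
      also have "\<dots> \<le> prob (nball N x t)"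
        using 2 t0 by (intro finite_measure_mono) (auto simp: nball_iff)
      finally show ?thesis by simp
    next
      case 3
      have "AE y in \<mu>. y \<in> nball N x t"
        using AE_supp by eventually_elim (use diam x 3 in \<open>force simp: nball_iff\<close>)
      then have "prob (nball N x t) = 1" by (subst prob_eq_1) auto
      then show ?thesis by simp
    qed
  qed
  have "ahlfors_quantization N \<mu> s r c C R"
    by unfold_locales (use sets_eq assms c C R lower upper diam in auto)
  then show thesis by (rule that)
qed

section \<open>Optimal sets and Voronoi cells\<close>

lemma optimal_setsD:
  assumes "\<alpha> \<in> optimal_sets N n r \<mu>"
  shows "finite \<alpha>" "\<alpha> \<noteq> {}" "card \<alpha> \<le> n"
  using assms unfolding optimal_sets_def codebooks_def by auto

lemma voronoiD:
  assumes P: "voronoi_partition N \<alpha> P" and \<alpha>: "finite \<alpha>" "\<alpha> \<noteq> {}"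
  shows "a \<in> \<alpha> \<Longrightarrow> P a \<in> sets borel"
    and "a \<in> \<alpha> \<Longrightarrow> y \<in> P a \<Longrightarrow> codist N \<alpha> y = N (y - a)"
    and "\<exists>a\<in>\<alpha>. y \<in> P a"
    and "disjoint_family_on P \<alpha>"
    and "(\<Union>a\<in>\<alpha>. P a) = UNIV"
proof -
  note P' = P[unfolded voronoi_partition_def]
  show "a \<in> \<alpha> \<Longrightarrow> P a \<in> sets borel" using P' by blast
  show "disjoint_family_on P \<alpha>" using P' by blast
  show U: "(\<Union>a\<in>\<alpha>. P a) = UNIV" using P' by blast
  then show "\<exists>a\<in>\<alpha>. y \<in> P a" by blast
  assume "a \<in> \<alpha>" "y \<in> P a"
  then have "ereal (ndist N y a) = nsetdist N y \<alpha>" using P' by blast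
  then show "codist N \<alpha> y = N (y - a)"
    by (simp add: nsetdist_eq_codist[OF \<alpha>] ndist_def)
qed

context ahlfors_quantization
begin

lemma space_eq [simp]: "space \<mu> = UNIV"
  using sets_eq_imp_space_eq[OF sets_eq] by simp

lemma AE_supp: "AE y in \<mu>. y \<in> supp \<mu>"
  by (rule AE_in_supp[OF sets_eq])

lemma supp_nonempty: obtains z where "z \<in> supp \<mu>"
  using AE_supp AE_const by (metis (mono_tags, lifting) eventually_mono)

lemma codist_supp_le:
  assumes "finite \<beta>" "\<beta> \<noteq> {}" "x \<in> supp \<mu>" "y \<in> supp \<mu>"
  shows "codist N \<beta> x \<le> R + codist N \<beta> y"
  using codist_triangle[OF assms(1,2), of x y] supp_diam[OF assms(3,4)] by simp

lemma integrable_codist: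
  assumes \<beta>: "finite \<beta>" "\<beta> \<noteq> {}"
  shows "integrable \<mu> (\<lambda>y. codist N \<beta> y powr r)"
proof -
  obtain z where z: "z \<in> supp \<mu>" by (rule supp_nonempty)
  show ?thesis
  proof (rule integrable_const_bound)
    show "AE y in \<mu>. norm (codist N \<beta> y powr r) \<le> (R + codist N \<beta> z) powr r"
      using AE_supp
    proof eventually_elim
      fix y assume "y \<in> supp \<mu>"
      then have "codist N \<beta> y powr r \<le> (R + codist N \<beta> z) powr r"
        using codist_supp_le[OF \<beta> _ z] codist_nonneg[OF \<beta>] r_pos by (intro powr_mono2) auto
      then show "norm (codist N \<beta> y powr r) \<le> (R + codist N \<beta> z) powr r" by simp
    qed
    show "(\<lambda>y. codist N \<beta> y powr r) \<in> borel_measurable \<mu>"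
      using codist_measurable[OF \<beta>(1)] by measurable
  qed
qed

text \<open>The real value of \<^const>\<open>distortion\<close>, which is finite because the support is bounded.\<close>

definition V :: "'a set \<Rightarrow> real" where
  "V \<beta> = (\<integral>y. codist N \<beta> y powr r \<partial>\<mu>)"

lemma V_nonneg: "0 \<le> V \<beta>"
  unfolding V_def by (intro integral_nonneg_AE) auto

lemma distortion_eq_V:
  assumes "finite \<beta>" "\<beta> \<noteq> {}"
  shows "distortion N r \<mu> \<beta> = ennreal (V \<beta>)"
  unfolding distortion_def V_def
  using nn_integral_eq_integral[OF integrable_codist[OF assms]]
  by (simp add: nsetdist_eq_codist[OF assms])

lemma optimal_V_le:
  assumes \<alpha>: "\<alpha> \<in> optimal_sets N n r \<mu>" and \<beta>: "finite \<beta>" "\<beta> \<noteq> {}" "card \<beta> \<le> n"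
  shows "V \<alpha> \<le> V \<beta>"
proof -
  have "\<beta> \<in> codebooks n"
    using \<beta> card_0_eq[OF \<beta>(1)] unfolding codebooks_def by (auto simp: Suc_le_eq card_gt_0_iff)
  then have "distortion N r \<mu> \<alpha> \<le> distortion N r \<mu> \<beta>"
    using \<alpha> unfolding optimal_sets_def by (auto intro: INF_lower)
  then show ?thesis
    using V_nonneg by (simp add: distortion_eq_V optimal_setsD[OF \<alpha>] \<beta>)
qed

lemma quant_error_powr:
  assumes \<alpha>: "\<alpha> \<in> optimal_sets N n r \<mu>"
  shows "quant_error N n r \<mu> powr r = V \<alpha>"
proof -
  have "(INF \<beta>\<in>codebooks n. distortion N r \<mu> \<beta>) = ennreal (V \<alpha>)"
    using \<alpha> optimal_setsD[OF \<alpha>] distortion_eq_V unfolding optimal_sets_def by auto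
  then show ?thesis
    using V_nonneg r_pos unfolding quant_error_def by (simp add: powr_powr)
qed

lemma cell_error_eq:
  assumes \<alpha>: "finite \<alpha>" "\<alpha> \<noteq> {}" and P: "voronoi_partition N \<alpha> P" and a: "a \<in> \<alpha>"
  shows "integrable \<mu> (\<lambda>y. codist N \<alpha> y powr r * indicator (P a) y)"
    and "cell_error N r \<mu> \<alpha> P a = (\<integral>y. codist N \<alpha> y powr r * indicator (P a) y \<partial>\<mu>)"
proof -
  have "P a \<in> sets \<mu>" using voronoiD(1)[OF P \<alpha> a] by (simp add: sets_eq)
  then show int: "integrable \<mu> (\<lambda>y. codist N \<alpha> y powr r * indicator (P a) y)"
    by (intro integrable_real_mult_indicator integrable_codist \<alpha>)
  have "(\<integral>\<^sup>+ y\<in>P a. ennreal (real_of_ereal (nsetdist N y \<alpha>) powr r) \<partial>\<mu>)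
      = (\<integral>\<^sup>+ y. ennreal (codist N \<alpha> y powr r * indicator (P a) y) \<partial>\<mu>)"
    by (intro nn_integral_cong) (simp add: nsetdist_eq_codist[OF \<alpha>] indicator_def)
  also have "\<dots> = ennreal (\<integral>y. codist N \<alpha> y powr r * indicator (P a) y \<partial>\<mu>)"
    using int by (intro nn_integral_eq_integral) auto
  finally show "cell_error N r \<mu> \<alpha> P a = (\<integral>y. codist N \<alpha> y powr r * indicator (P a) y \<partial>\<mu>)"
    unfolding cell_error_def by (simp add: integral_nonneg_AE)
qed

section \<open>Exchanging a codebook point\<close>

text \<open>
  On the ball of radius \<open>h/4\<close> around a point at distance at least \<open>h\<close> from the codebook, the
  distance to the codebook is at least \<open>3h/4\<close>, so adding the centre lowers the integrand by at
  least \<open>\<kappa> * h powr r\<close>.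
\<close>

definition \<kappa> :: real where
  "\<kappa> = (3/4) powr r - (1/4) powr r"

lemma \<kappa>_pos: "0 < \<kappa>"
  using r_pos powr_less_mono2[of r "1/4" "3/4"] unfolding \<kappa>_def by simp

text \<open>
  The integrands are compared pointwise. The ball around \<open>x\<close> takes precedence over \<open>A\<close>: on it the
  distance to \<open>\<beta>\<close> is controlled by \<open>x\<close> alone, so the saving is not diminished where the ball
  meets the region \<open>A\<close> that loses its codebook point. With \<open>h = 0\<close> there is no saving, so that
  the lemma also covers pure deletions.
\<close>

lemma V_perturb:
  assumes \<alpha>: "finite \<alpha>" "\<alpha> \<noteq> {}" and \<beta>: "finite \<beta>"
    and x: "x \<in> \<beta>" and h: "0 \<le> h" "h \<le> codist N \<alpha> x"
    and A: "A \<in> sets borel" and G: "0 \<le> G"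
    and off: "\<And>y. y \<in> supp \<mu> \<Longrightarrow> y \<notin> A \<Longrightarrow> codist N \<beta> y \<le> codist N \<alpha> y"
    and on: "\<And>y. y \<in> supp \<mu> \<Longrightarrow> y \<in> A \<Longrightarrow> codist N \<beta> y \<le> G"
  shows "V \<beta> \<le> V \<alpha> - \<kappa> * h powr r * prob (nball N x (h/4)) + G powr r * prob A"
proof -
  have \<beta>_ne: "\<beta> \<noteq> {}" using x by auto
  note pos = codist_nonneg[OF \<alpha>] codist_nonneg[OF \<beta> \<beta>_ne]
  let ?B = "nball N x (h/4)"
  have [measurable]: "A \<in> sets \<mu>" "?B \<in> sets \<mu>" using A by (simp_all add: sets_eq)
  let ?f = "\<lambda>y. codist N \<alpha> y powr r - \<kappa> * h powr r * indicator ?B y + G powr r * indicator A y"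
  have ind: "integrable \<mu> (indicat_real ?B)" "integrable \<mu> (indicat_real A)"
    by (auto intro!: integrable_real_indicator simp: less_top[symmetric])
  note ints = integrable_codist[OF \<alpha>] integrable_mult_right[OF ind(1), of "\<kappa> * h powr r"]
    integrable_mult_right[OF ind(2), of "G powr r"]
  have int: "integrable \<mu> ?f" using ints by auto
  have "V \<beta> \<le> (\<integral>y. ?f y \<partial>\<mu>)"
    unfolding V_def
  proof (rule integral_mono_AE[OF integrable_codist[OF \<beta> \<beta>_ne] int])
    show "AE y in \<mu>. codist N \<beta> y powr r \<le> ?f y"
      using AE_supp
    proof eventually_elim
      fix y assume y: "y \<in> supp \<mu>"
      show "codist N \<beta> y powr r \<le> ?f y"
      proof (cases "y \<in> ?B")
        case True
        then have near: "codist N \<beta> y \<le> h/4"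
          using codist_le[OF \<beta> x, of N y] by (simp add: nball_iff)
        have far: "3 * h/4 \<le> codist N \<alpha> y"
          using h(2) codist_triangle[OF \<alpha>, of x y] True N_commute[of x y] by (simp add: nball_iff)
        have "codist N \<beta> y powr r \<le> (h/4) powr r"
          using near pos r_pos by (intro powr_mono2) auto
        also have "\<dots> = (3 * h/4) powr r - \<kappa> * h powr r"
          using h unfolding \<kappa>_def by (simp add: powr_mult powr_divide algebra_simps)
        also have "\<dots> \<le> codist N \<alpha> y powr r - \<kappa> * h powr r"
          using far h r_pos by (intro diff_mono powr_mono2) auto
        finally show ?thesis using True by (auto simp: indicator_def intro: add_increasing2)
      next
        case False
        show ?thesis
        proof (cases "y \<in> A")
          case True
          have "codist N \<beta> y powr r \<le> G powr r"
            using on[OF y True] pos r_pos by (intro powr_mono2) auto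
          then show ?thesis using True False by (simp add: add_increasing)
        next
          case False
          have "codist N \<beta> y powr r \<le> codist N \<alpha> y powr r"
            using off[OF y False] pos r_pos by (intro powr_mono2) auto
          then show ?thesis using \<open>y \<notin> ?B\<close> False by simp
        qed
      qed
    qed
  qed
  also have "\<dots> = V \<alpha> - \<kappa> * h powr r * prob ?B + G powr r * prob A"
    unfolding V_def using ints by simp
  finally show ?thesis .
qed

lemma V_insert:
  assumes \<alpha>: "finite \<alpha>" "\<alpha> \<noteq> {}" and h: "0 \<le> h" "h \<le> codist N \<alpha> x"
  shows "V (insert x \<alpha>) \<le> V \<alpha> - \<kappa> * h powr r * prob (nball N x (h/4))"
proof -
  have "codist N (insert x \<alpha>) y \<le> codist N \<alpha> y" for y
    using codist_attained[OF \<alpha>, of N y] codist_le[of "insert x \<alpha>" _ N y] \<alpha>(1) by (metis finite_insert insertI2)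
  then show ?thesis
    using V_perturb[OF \<alpha>, of "insert x \<alpha>" x h "{}" 0] \<alpha> h by auto
qed

text \<open>Points outside the cell of \<open>a\<close> keep their nearest codebook point when \<open>a\<close> is deleted.\<close>

lemma off_cell:
  assumes \<alpha>: "finite \<alpha>" "\<alpha> \<noteq> {}" and P: "voronoi_partition N \<alpha> P"
    and \<beta>: "finite \<beta>" "\<alpha> - {a} \<subseteq> \<beta>" and y: "y \<notin> P a"
  shows "codist N \<beta> y \<le> codist N \<alpha> y"
proof -
  obtain b where b: "b \<in> \<alpha>" "y \<in> P b" using voronoiD(3)[OF P \<alpha>] by blast
  then show ?thesis
    using y voronoiD(2)[OF P \<alpha> b] \<beta> by (intro codist_le_codist[of \<beta> b]) auto
qed

lemma V_exchange:
  assumes \<alpha>: "finite \<alpha>" "\<alpha> \<noteq> {}" and P: "voronoi_partition N \<alpha> P" and a: "a \<in> \<alpha>"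
    and h: "0 \<le> h" "h \<le> codist N \<alpha> x" and G: "0 \<le> G"
    and nb: "\<And>y. y \<in> supp \<mu> \<Longrightarrow> y \<in> P a \<Longrightarrow> \<exists>b\<in>\<alpha> - {a}. N (y - b) \<le> G"
  shows "V (insert x (\<alpha> - {a})) \<le> V \<alpha> - \<kappa> * h powr r * prob (nball N x (h/4)) + G powr r * prob (P a)"
proof (rule V_perturb[OF \<alpha> _ _ h voronoiD(1)[OF P \<alpha> a] G])
  show "finite (insert x (\<alpha> - {a}))" using \<alpha> by simp
  show "x \<in> insert x (\<alpha> - {a})" by simp
  show "codist N (insert x (\<alpha> - {a})) y \<le> codist N \<alpha> y" if "y \<notin> P a" for y
    using that \<alpha>(1) by (intro off_cell[OF \<alpha> P]) auto
  show "codist N (insert x (\<alpha> - {a})) y \<le> G" if "y \<in> supp \<mu>" "y \<in> P a" for y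
    using nb[OF that] codist_le[of "insert x (\<alpha> - {a})" _ N y] \<alpha>(1)
    by (meson finite_Diff finite_insert insertI2 order_trans)
qed

lemma V_delete:
  assumes \<alpha>: "finite \<alpha>" "\<alpha> - {a} \<noteq> {}" and P: "voronoi_partition N \<alpha> P" and a: "a \<in> \<alpha>"
    and G: "0 \<le> G"
    and nb: "\<And>y. y \<in> supp \<mu> \<Longrightarrow> y \<in> P a \<Longrightarrow> \<exists>b\<in>\<alpha> - {a}. N (y - b) \<le> G"
  shows "V (\<alpha> - {a}) \<le> V \<alpha> + G powr r * prob (P a)"
proof -
  obtain x where x: "x \<in> \<alpha> - {a}" using \<alpha> by auto
  have ne: "\<alpha> \<noteq> {}" using a by auto
  show ?thesis
    using V_exchange[OF \<alpha>(1) ne P a, of 0 x G] codist_nonneg[OF \<alpha>(1) ne] G nb x r_pos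
    by (simp add: insert_absorb)
qed

text \<open>
  A point \<open>z\<close> of the support with \<open>d(z, y) \<le> D\<close> that lies in the cell of some \<open>b\<close> forces
  \<open>d(y, b) \<le> 2 * D\<close>. If no \<open>b\<close> other than \<open>a\<close> is that close to \<open>y\<close>, the cell of \<open>a\<close> contains almost
  all of the ball of radius \<open>D\<close> around \<open>y\<close> and is too heavy.
\<close>

lemma neighbour:
  assumes \<alpha>: "finite \<alpha>" "\<alpha> \<noteq> {}" and P: "voronoi_partition N \<alpha> P" and a: "a \<in> \<alpha>"
    and D: "0 < D" and cover: "\<And>z. z \<in> supp \<mu> \<Longrightarrow> codist N \<alpha> z \<le> D"
    and light: "prob (P a) < min 1 (c * D powr s)" and y: "y \<in> supp \<mu>"
  shows "\<exists>b\<in>\<alpha> - {a}. N (y - b) \<le> 2 * D"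
proof (rule ccontr)
  assume none: "\<not> (\<exists>b\<in>\<alpha> - {a}. N (y - b) \<le> 2 * D)"
  have "AE z in \<mu>. z \<in> nball N y D \<longrightarrow> z \<in> P a"
    using AE_supp
  proof eventually_elim
    fix z assume z: "z \<in> supp \<mu>"
    show "z \<in> nball N y D \<longrightarrow> z \<in> P a"
    proof
      assume "z \<in> nball N y D"
      then have zy: "N (y - z) \<le> D" using N_commute[of y z] by (simp add: nball_iff)
      obtain b where b: "b \<in> \<alpha>" "z \<in> P b" using voronoiD(3)[OF P \<alpha>] by blast
      then have "N (y - b) \<le> 2 * D"
        using N_triangle3[of y b z] zy cover[OF z] voronoiD(2)[OF P \<alpha> b] by simp
      then show "z \<in> P a" using none b by auto
    qed
  qed
  then have "prob (nball N y D) \<le> prob (P a)"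
    using voronoiD(1)[OF P \<alpha> a] by (intro finite_measure_mono_AE) (auto simp: sets_eq)
  then show False using ball_lower[OF y D] light by simp
qed

lemma light_cell:
  assumes \<alpha>: "finite \<alpha>" "\<alpha> \<noteq> {}" and P: "voronoi_partition N \<alpha> P"
  obtains a where "a \<in> \<alpha>" "prob (P a) \<le> 1 / card \<alpha>"
proof -
  have "(\<Sum>a\<in>\<alpha>. prob (P a)) = prob (\<Union>a\<in>\<alpha>. P a)"
    using voronoiD[OF P \<alpha>] \<alpha> by (intro finite_measure_finite_Union[symmetric]) (auto simp: sets_eq)
  also have "\<dots> = 1" using voronoiD(5)[OF P \<alpha>] prob_space by simp
  finally have sum: "(\<Sum>a\<in>\<alpha>. prob (P a)) = 1" .
  have "\<exists>a\<in>\<alpha>. prob (P a) \<le> 1 / card \<alpha>"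
  proof (rule ccontr)
    assume "\<not> (\<exists>a\<in>\<alpha>. prob (P a) \<le> 1 / card \<alpha>)"
    then have "(\<Sum>a\<in>\<alpha>. 1 / card \<alpha>) < (\<Sum>a\<in>\<alpha>. prob (P a))"
      using \<alpha> by (intro sum_strict_mono) auto
    then show False using sum \<alpha> by simp
  qed
  then show thesis using that by auto
qed

section \<open>Lower bounds from points far from the codebook\<close>

text \<open>The radius at which a ball has mass of order \<open>1/n\<close>.\<close>

definition rho :: "nat \<Rightarrow> real" where
  "rho n = real n powr (- 1 / s)"

lemma rho_pos: "1 \<le> n \<Longrightarrow> 0 < rho n"
  unfolding rho_def by simp

lemma rho_antimono: "1 \<le> m \<Longrightarrow> m \<le> n \<Longrightarrow> rho n \<le> rho m"
  unfolding rho_def using s_pos by (intro powr_mono2') auto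

lemma powr_s_rho: "0 \<le> D \<Longrightarrow> 1 \<le> n \<Longrightarrow> (D * rho n) powr s = D powr s / n"
  unfolding rho_def using s_pos by (simp add: powr_mult powr_powr powr_minus_divide powr_divide)

lemma powr_r_rho: "0 \<le> D \<Longrightarrow> (D * rho n) powr r = D powr r * rho n powr r"
  unfolding rho_def by (simp add: powr_mult)

lemma ball_lower_rho:
  assumes x: "x \<in> supp \<mu>" and t: "0 < t" and n: "1 \<le> n"
  shows "min 1 (c * t powr s) / n \<le> prob (nball N x (t * rho n))"
proof -
  have "min 1 (c * t powr s) / n \<le> min 1 (c * t powr s / n)"
    using n c_pos by (auto simp: min_def field_simps)
  also have "\<dots> = min 1 (c * (t * rho n) powr s)"
    using t n by (simp add: powr_s_rho)
  also have "\<dots> \<le> prob (nball N x (t * rho n))"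
    using t rho_pos[OF n] by (intro ball_lower[OF x]) auto
  finally show ?thesis .
qed

text \<open>Chosen such that \<open>n\<close> balls of radius \<open>gap * rho n\<close> have total mass at most \<open>1/2\<close>.\<close>

definition gap :: real where
  "gap = (1 / (2 * C)) powr (1 / s)"

lemma gap_pos: "0 < gap"
  using C_pos unfolding gap_def by simp

lemma gap_powr_s: "C * gap powr s = 1 / 2"
  using C_pos s_pos unfolding gap_def by (simp add: powr_powr)

lemma far_set_measurable:
  assumes "finite \<alpha>"
  shows "{y. t \<le> codist N \<alpha> y} \<in> sets \<mu>"
proof -
  have "{y \<in> space borel. t \<le> codist N \<alpha> y} \<in> sets borel"
    using codist_measurable[OF assms] by measurable
  then show ?thesis by (simp add: sets_eq)
qed

lemma gap_prob:
  assumes \<alpha>: "finite \<alpha>" "\<alpha> \<noteq> {}" "card \<alpha> \<le> n"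
  shows "1 / 2 \<le> prob {y. gap * rho n \<le> codist N \<alpha> y}"
proof -
  have n: "1 \<le> n" using \<alpha> card_gt_0_iff[of \<alpha>] by linarith
  let ?t = "gap * rho n"
  let ?U = "\<Union>a\<in>\<alpha>. nball N a ?t"
  have U [measurable]: "?U \<in> sets \<mu>" using \<alpha>(1) by (auto simp: sets_eq)
  have "prob ?U \<le> (\<Sum>a\<in>\<alpha>. prob (nball N a ?t))"
    using \<alpha>(1) by (intro finite_measure_subadditive_finite) (auto simp: sets_eq)
  also have "\<dots> \<le> (\<Sum>a\<in>\<alpha>. 1 / (2 * n))"
  proof (rule sum_mono)
    fix a assume "a \<in> \<alpha>"
    have "prob (nball N a ?t) \<le> C * ?t powr s"
      using gap_pos rho_pos[OF n] by (intro ball_upper) auto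
    also have "\<dots> = 1 / (2 * n)"
      using gap_powr_s gap_pos n by (simp add: powr_s_rho field_simps)
    finally show "prob (nball N a ?t) \<le> 1 / (2 * n)" .
  qed
  also have "\<dots> \<le> 1 / 2" using \<alpha>(3) n by (simp add: field_simps)
  finally have "1 / 2 \<le> prob (space \<mu> - ?U)" by (subst prob_compl) auto
  also have "\<dots> \<le> prob {y. ?t \<le> codist N \<alpha> y}"
  proof (rule finite_measure_mono)
    show "space \<mu> - ?U \<subseteq> {y. ?t \<le> codist N \<alpha> y}"
    proof
      fix y assume y: "y \<in> space \<mu> - ?U"
      obtain a where "a \<in> \<alpha>" "codist N \<alpha> y = N (y - a)" using codist_attained[OF \<alpha>(1,2)] .
      then show "y \<in> {y. ?t \<le> codist N \<alpha> y}" using y by (force simp: nball_iff)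
    qed
  qed (rule far_set_measurable[OF \<alpha>(1)])
  finally show ?thesis .
qed

lemma gap_point:
  assumes \<alpha>: "finite \<alpha>" "\<alpha> \<noteq> {}" "card \<alpha> \<le> n"
  obtains x where "x \<in> supp \<mu>" "gap * rho n \<le> codist N \<alpha> x"
proof -
  have "\<exists>x\<in>supp \<mu>. gap * rho n \<le> codist N \<alpha> x"
  proof (rule ccontr)
    assume "\<not> ?thesis"
    then have "AE y in \<mu>. y \<notin> {y. gap * rho n \<le> codist N \<alpha> y}"
      using AE_supp by (auto elim!: eventually_mono)
    then have "prob {y. gap * rho n \<le> codist N \<alpha> y} = 0"
      by (subst prob_eq_0[OF far_set_measurable[OF \<alpha>(1)]])
    then show False using gap_prob[OF \<alpha>] by simp
  qed
  then show thesis using that by auto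
qed

lemma V_lower:
  assumes \<alpha>: "finite \<alpha>" "\<alpha> \<noteq> {}" "card \<alpha> \<le> n"
  shows "gap powr r / 2 * rho n powr r \<le> V \<alpha>"
proof -
  have n: "1 \<le> n" using \<alpha> card_gt_0_iff[of \<alpha>] by linarith
  let ?A = "{y. gap * rho n \<le> codist N \<alpha> y}"
  note A = far_set_measurable[OF \<alpha>(1), of "gap * rho n"]
  have "gap powr r / 2 * rho n powr r \<le> (gap * rho n) powr r * prob ?A"
    using gap_prob[OF \<alpha>] mult_left_mono[of "1/2" "prob ?A" "(gap * rho n) powr r"] gap_pos
    by (simp add: powr_r_rho)
  also have "\<dots> = (\<integral>y. (gap * rho n) powr r * indicator ?A y \<partial>\<mu>)" by simp
  also have "\<dots> \<le> V \<alpha>"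
    unfolding V_def
  proof (rule integral_mono)
    show "integrable \<mu> (\<lambda>y. (gap * rho n) powr r * indicator ?A y)"
      using A by (intro integrable_mult_right integrable_real_indicator) (auto simp: less_top[symmetric])
    show "integrable \<mu> (\<lambda>y. codist N \<alpha> y powr r)" by (rule integrable_codist[OF \<alpha>(1,2)])
    show "(gap * rho n) powr r * indicator ?A y \<le> codist N \<alpha> y powr r" for y
      using gap_pos rho_pos[OF n] r_pos by (auto simp: indicator_def intro!: powr_mono2)
  qed
  finally show ?thesis .
qed

definition gain :: real where
  "gain = \<kappa> * gap powr r * min 1 (c * (gap / 4) powr s)"

lemma gain_pos: "0 < gain"
  using \<kappa>_pos gap_pos c_pos unfolding gain_def by simp

lemma gain_le:
  assumes "x \<in> supp \<mu>" and n: "1 \<le> n"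
  shows "gain * rho n powr r / n \<le> \<kappa> * (gap * rho n) powr r * prob (nball N x (gap * rho n / 4))"
proof -
  have "gain * rho n powr r / n
      = \<kappa> * (gap * rho n) powr r * (min 1 (c * (gap / 4) powr s) / n)"
    unfolding gain_def using gap_pos by (simp add: powr_r_rho)
  also have "\<dots> \<le> \<kappa> * (gap * rho n) powr r * prob (nball N x (gap / 4 * rho n))"
    using gap_pos \<kappa>_pos assms by (intro mult_left_mono ball_lower_rho) auto
  finally show ?thesis by simp
qed

text \<open>
  One additional point lowers the distortion of any codebook by the full order, not only that of
  an optimal one; in particular optimal sets use all points they may (\<open>card_optimal\<close>).
\<close>

lemma V_insert_gain:
  assumes \<alpha>: "finite \<alpha>" "\<alpha> \<noteq> {}" "card \<alpha> \<le> n"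
  obtains x where "V (insert x \<alpha>) \<le> V \<alpha> - gain * rho n powr r / n"
proof -
  have n: "1 \<le> n" using \<alpha> card_gt_0_iff[of \<alpha>] by linarith
  obtain x where x: "x \<in> supp \<mu>" "gap * rho n \<le> codist N \<alpha> x" by (rule gap_point[OF \<alpha>])
  have "0 \<le> gap * rho n" using gap_pos rho_pos[OF n] by simp
  from V_insert[OF \<alpha>(1,2) this x(2)] gain_le[OF x(1) n] show thesis
    by (intro that[of x]) linarith
qed

lemma card_optimal:
  assumes \<alpha>: "\<alpha> \<in> optimal_sets N n r \<mu>"
  shows "card \<alpha> = n"
proof (rule ccontr)
  assume ne: "card \<alpha> \<noteq> n"
  note opt = optimal_setsD[OF \<alpha>]
  obtain x where x: "V (insert x \<alpha>) \<le> V \<alpha> - gain * rho n powr r / n"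
    by (rule V_insert_gain[OF opt])
  have n: "1 \<le> n" using opt card_gt_0_iff[of \<alpha>] by linarith
  have "V \<alpha> \<le> V (insert x \<alpha>)"
    using opt ne by (intro optimal_V_le[OF \<alpha>]) (auto simp: card_insert_if)
  moreover have "0 < gain * rho n powr r / n"
    using gain_pos rho_pos[OF n] n by simp
  ultimately show False using x by linarith
qed

section \<open>Optimal sets cover the support\<close>

lemma optimal_exchange:
  assumes \<alpha>: "\<alpha> \<in> optimal_sets N n r \<mu>" and P: "voronoi_partition N \<alpha> P" and a: "a \<in> \<alpha>"
    and h: "0 \<le> h" "h \<le> codist N \<alpha> x" and G: "0 \<le> G"
    and nb: "\<And>y. y \<in> supp \<mu> \<Longrightarrow> y \<in> P a \<Longrightarrow> \<exists>b\<in>\<alpha> - {a}. N (y - b) \<le> G"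
  shows "\<kappa> * h powr r * prob (nball N x (h/4)) \<le> G powr r * prob (P a)"
proof -
  note opt = optimal_setsD[OF \<alpha>]
  have "V \<alpha> \<le> V (insert x (\<alpha> - {a}))"
  proof (rule optimal_V_le[OF \<alpha>])
    have "card (insert x (\<alpha> - {a})) \<le> Suc (card (\<alpha> - {a}))" by (rule card_insert_le_m1) auto
    also have "\<dots> = card \<alpha>" using a opt(1) by (metis card_Suc_Diff1)
    finally show "card (insert x (\<alpha> - {a})) \<le> n" using opt(3) by simp
  qed (use opt in auto)
  then show ?thesis using V_exchange[OF opt(1,2) P a h G nb] by simp
qed

text \<open>
  An a priori bound, coarse but uniform in \<open>n\<close>. A single point of the support has distortion at
  most \<open>R powr r\<close>, so an optimal set comes within \<open>2 * R\<close> of some point of the support. It settles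
  \<open>n = 1\<close> in \<open>optimal_covering\<close> and otherwise keeps the radius in the range in which the truncated
  lower bound for the mass of a ball is a genuine multiple of its \<open>s\<close>th power.
\<close>

lemma codist_optimal_le_diam:
  assumes \<alpha>: "\<alpha> \<in> optimal_sets N n r \<mu>" and x: "x \<in> supp \<mu>"
  shows "codist N \<alpha> x \<le> 3 * R"
proof -
  note opt = optimal_setsD[OF \<alpha>]
  have n: "1 \<le> n" using opt card_gt_0_iff[of \<alpha>] by linarith
  have "V {x} \<le> (\<integral>y. R powr r \<partial>\<mu>)"
    unfolding V_def
  proof (rule integral_mono_AE)
    show "AE y in \<mu>. codist N {x} y powr r \<le> R powr r"
      using AE_supp
      by eventually_elim (use supp_diam x r_pos in \<open>auto simp: codist_def intro!: powr_mono2\<close>)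
  qed (auto intro: integrable_codist)
  then have le: "V \<alpha> \<le> R powr r"
    using optimal_V_le[OF \<alpha>, of "{x}"] n prob_space by simp
  have "\<exists>y\<in>supp \<mu>. codist N \<alpha> y < 2 * R"
  proof (rule ccontr)
    assume none: "\<not> ?thesis"
    have "(\<integral>y. (2 * R) powr r \<partial>\<mu>) \<le> V \<alpha>"
      unfolding V_def
    proof (rule integral_mono_AE)
      show "AE y in \<mu>. (2 * R) powr r \<le> codist N \<alpha> y powr r"
        using AE_supp
        by eventually_elim (use none R_pos r_pos in \<open>auto intro!: powr_mono2\<close>)
    qed (simp_all add: integrable_codist opt(1,2))
    moreover have "R powr r < (2 * R) powr r" using R_pos r_pos by (intro powr_less_mono2) auto
    ultimately show False using le prob_space by simp
  qed
  then show ?thesis using codist_supp_le[OF opt(1,2) x] by fastforce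
qed

text \<open>
  Let \<open>D\<close> be the supremum of the distances to \<open>\<alpha>\<close>. It serves both as the radius up to which the
  points of a light cell find other neighbours and, up to the factor 2, as the distance of the
  point that is inserted. The cost \<open>(2 * D) powr r / n\<close> and the saving, of order
  \<open>D powr (r + s)\<close>, share the factor \<open>D powr r\<close>.
\<close>

lemma optimal_covering:
  obtains D where "0 < D"
    "\<And>n \<alpha> P x. 1 \<le> n \<Longrightarrow> \<alpha> \<in> optimal_sets N n r \<mu> \<Longrightarrow> voronoi_partition N \<alpha> P
       \<Longrightarrow> x \<in> supp \<mu> \<Longrightarrow> codist N \<alpha> x \<le> D * rho n"
proof -
  \<comment> \<open>A ball of radius \<open>D / 8 \<le> 3 * R / 8\<close> around a support point has mass at least \<open>c' * D powr s\<close>.\<close>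
  define c' where "c' = min (1 / (3 * R) powr s) (c / 8 powr s)"
  have c': "0 < c'" using R_pos c_pos unfolding c'_def by simp
  \<comment> \<open>For \<open>D powr s > E / n\<close> the first entry makes a cell of mass \<open>1/n\<close> light and the second violates the exchange inequality.\<close>
  define E where "E = max (1 / c) (4 powr r / (\<kappa> * c'))"
  have E: "0 < E" using c_pos unfolding E_def by (intro less_le_trans[OF _ max.cobounded1]) simp
  define D0 where "D0 = max (3 * R) (E powr (1 / s))"
  have D0: "0 < D0" using R_pos unfolding D0_def by simp
  have "E = (E powr (1 / s)) powr s" using E s_pos by (simp add: powr_powr)
  also have "\<dots> \<le> D0 powr s" unfolding D0_def using s_pos by (intro powr_mono2) auto
  finally have D0_s: "E \<le> D0 powr s" .
  have cover: "codist N \<alpha> x \<le> D0 * rho n"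
    if n: "1 \<le> n" and \<alpha>: "\<alpha> \<in> optimal_sets N n r \<mu>" and P: "voronoi_partition N \<alpha> P"
      and x: "x \<in> supp \<mu>" for n \<alpha> P x
  proof (cases "n = 1")
    case True
    then show ?thesis
      using codist_optimal_le_diam[OF \<alpha> x] unfolding D0_def rho_def by simp
  next
    case False
    then have n2: "2 \<le> n" using n by simp
    note opt = optimal_setsD[OF \<alpha>]
    define D where "D = (SUP y\<in>supp \<mu>. codist N \<alpha> y)"
    have bdd: "bdd_above (codist N \<alpha> ` supp \<mu>)"
      using codist_optimal_le_diam[OF \<alpha>] by (auto intro: bdd_aboveI[of _ "3 * R"])
    have le_D: "codist N \<alpha> y \<le> D" if "y \<in> supp \<mu>" for y
      unfolding D_def using that bdd by (intro cSUP_upper)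
    have D_le: "D \<le> 3 * R"
      unfolding D_def using codist_optimal_le_diam[OF \<alpha>] x by (intro cSUP_least) auto
    have "D \<le> D0 * rho n"
    proof (rule ccontr)
      assume "\<not> D \<le> D0 * rho n"
      then have less: "D0 * rho n < D" by simp
      have D: "0 < D" using less D0 rho_pos[OF n] by (meson less_trans mult_pos_pos)
      have "E / n \<le> D0 powr s / n" using D0_s by (intro divide_right_mono) auto
      also have "\<dots> = (D0 * rho n) powr s" using D0 n by (simp add: powr_s_rho)
      also have "\<dots> < D powr s" using less D0 rho_pos[OF n] s_pos by (intro powr_less_mono2) auto
      finally have big: "E < n * D powr s" using n by (simp add: field_simps)
      obtain a where a: "a \<in> \<alpha>" "prob (P a) \<le> 1 / n"
        using light_cell[OF opt(1,2) P] card_optimal[OF \<alpha>] by metis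
      have "1 / c < n * D powr s" using big unfolding E_def by simp
      then have "1 / n < c * D powr s" using c_pos n by (simp add: field_simps)
      moreover have "1 / n < (1::real)" using n2 by simp
      ultimately have light: "prob (P a) < min 1 (c * D powr s)" using a(2) by simp
      have "\<exists>y\<in>supp \<mu>. D / 2 < codist N \<alpha> y"
        using less_cSUP_iff[OF _ bdd, of "D / 2"] x D unfolding D_def by auto
      then obtain y where y: "y \<in> supp \<mu>" "D / 2 \<le> codist N \<alpha> y" by force
      have "\<kappa> * (D / 2) powr r * prob (nball N y (D / 2 / 4)) \<le> (2 * D) powr r * prob (P a)"
        using y(2) D neighbour[OF opt(1,2) P a(1) D le_D light]
        by (intro optimal_exchange[OF \<alpha> P a(1)]) auto
      also have "\<dots> \<le> (2 * D) powr r * (1 / n)" using a(2) by (intro mult_left_mono) auto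
      finally have upper: "\<kappa> * (D / 2) powr r * prob (nball N y (D / 8)) \<le> (2 * D) powr r / n"
        by simp
      have "c' * D powr s \<le> min 1 (c * (D / 8) powr s)"
      proof (rule min.boundedI)
        have "c' * D powr s \<le> (1 / (3 * R) powr s) * (3 * R) powr s"
          unfolding c'_def using D D_le s_pos by (intro mult_mono powr_mono2) auto
        then show "c' * D powr s \<le> 1" using R_pos by simp
        have "c' * D powr s \<le> c / 8 powr s * D powr s"
          unfolding c'_def by (intro mult_right_mono) auto
        then show "c' * D powr s \<le> c * (D / 8) powr s" using D by (simp add: powr_divide)
      qed
      also have "\<dots> \<le> prob (nball N y (D / 8))" using D by (intro ball_lower y) auto
      finally have "\<kappa> * (D / 2) powr r * (c' * D powr s) \<le> \<kappa> * (D / 2) powr r * prob (nball N y (D / 8))"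
        using \<kappa>_pos by (intro mult_left_mono) auto
      also note upper
      also have "(2 * D) powr r = 4 powr r * (D / 2) powr r"
        using D by (simp flip: powr_mult)
      finally have "\<kappa> * c' * (n * D powr s) \<le> 4 powr r"
        using D n by (simp add: field_simps)
      then have "n * D powr s \<le> 4 powr r / (\<kappa> * c')"
        using \<kappa>_pos c' by (simp add: field_simps)
      then show False using big unfolding E_def by simp
    qed
    then show ?thesis using le_D[OF x] by simp
  qed
  show thesis by (rule that[OF D0 cover])
qed

section \<open>Consequences of the covering bound\<close>

lemma V_optimal_upper:
  obtains B where "0 < B"
    "\<And>n \<alpha> P. 1 \<le> n \<Longrightarrow> \<alpha> \<in> optimal_sets N n r \<mu> \<Longrightarrow> voronoi_partition N \<alpha> P
       \<Longrightarrow> V \<alpha> \<le> B * rho n powr r"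
proof -
  obtain D where D: "0 < D" and cover: "\<And>n \<alpha> P x. 1 \<le> n \<Longrightarrow> \<alpha> \<in> optimal_sets N n r \<mu>
      \<Longrightarrow> voronoi_partition N \<alpha> P \<Longrightarrow> x \<in> supp \<mu> \<Longrightarrow> codist N \<alpha> x \<le> D * rho n"
    by (rule optimal_covering, rule that; blast)
  have "V \<alpha> \<le> D powr r * rho n powr r"
    if n: "1 \<le> n" and \<alpha>: "\<alpha> \<in> optimal_sets N n r \<mu>" and P: "voronoi_partition N \<alpha> P" for n \<alpha> P
  proof -
    note opt = optimal_setsD[OF \<alpha>]
    have "V \<alpha> \<le> (\<integral>y. (D * rho n) powr r \<partial>\<mu>)"
      unfolding V_def
    proof (rule integral_mono_AE)
      show "AE y in \<mu>. codist N \<alpha> y powr r \<le> (D * rho n) powr r"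
        using AE_supp
        by eventually_elim
          (use cover[OF n \<alpha> P] codist_nonneg[OF opt(1,2)] r_pos in \<open>auto intro!: powr_mono2\<close>)
    qed (simp_all add: integrable_codist opt(1,2))
    then show ?thesis using D prob_space by (simp add: powr_r_rho)
  qed
  then show thesis using D by (intro that[of "D powr r"]) auto
qed

lemma cell_error_upper:
  obtains B where "0 < B"
    "\<And>n \<alpha> P a. 1 \<le> n \<Longrightarrow> \<alpha> \<in> optimal_sets N n r \<mu> \<Longrightarrow> voronoi_partition N \<alpha> P \<Longrightarrow> a \<in> \<alpha>
       \<Longrightarrow> cell_error N r \<mu> \<alpha> P a \<le> B * (rho n powr r / n)"
proof -
  obtain D where D: "0 < D" and cover: "\<And>n \<alpha> P x. 1 \<le> n \<Longrightarrow> \<alpha> \<in> optimal_sets N n r \<mu>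
      \<Longrightarrow> voronoi_partition N \<alpha> P \<Longrightarrow> x \<in> supp \<mu> \<Longrightarrow> codist N \<alpha> x \<le> D * rho n"
    by (rule optimal_covering, rule that; blast)
  have "cell_error N r \<mu> \<alpha> P a \<le> (D powr r * (C * D powr s)) * (rho n powr r / n)"
    if n: "1 \<le> n" and \<alpha>: "\<alpha> \<in> optimal_sets N n r \<mu>" and P: "voronoi_partition N \<alpha> P"
      and a: "a \<in> \<alpha>" for n \<alpha> P a
  proof -
    note opt = optimal_setsD[OF \<alpha>]
    let ?B = "nball N a (D * rho n)"
    have B: "?B \<in> sets \<mu>" by (simp add: sets_eq)
    have "cell_error N r \<mu> \<alpha> P a \<le> (\<integral>y. (D * rho n) powr r * indicator ?B y \<partial>\<mu>)"
      unfolding cell_error_eq(2)[OF opt(1,2) P a]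
    proof (rule integral_mono_AE[OF cell_error_eq(1)[OF opt(1,2) P a]])
      show "integrable \<mu> (\<lambda>y. (D * rho n) powr r * indicator ?B y)"
        using B by (intro integrable_mult_right integrable_real_indicator) (auto simp: less_top[symmetric])
      show "AE y in \<mu>. codist N \<alpha> y powr r * indicator (P a) y \<le> (D * rho n) powr r * indicator ?B y"
        using AE_supp
      proof eventually_elim
        fix y assume y: "y \<in> supp \<mu>"
        show "codist N \<alpha> y powr r * indicator (P a) y \<le> (D * rho n) powr r * indicator ?B y"
        proof (cases "y \<in> P a")
          case True
          then have "y \<in> ?B"
            using cover[OF n \<alpha> P y] voronoiD(2)[OF P opt(1,2) a True] by (simp add: nball_iff)
          moreover have "codist N \<alpha> y powr r \<le> (D * rho n) powr r"
            using cover[OF n \<alpha> P y] codist_nonneg[OF opt(1,2)] r_pos by (intro powr_mono2) auto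
          ultimately show ?thesis using True by simp
        qed simp
      qed
    qed
    also have "\<dots> = (D * rho n) powr r * prob ?B" by simp
    also have "\<dots> \<le> (D * rho n) powr r * (C * (D * rho n) powr s)"
      using D rho_pos[OF n] by (intro mult_left_mono ball_upper) auto
    also have "\<dots> = (D powr r * (C * D powr s)) * (rho n powr r / n)"
      using D n by (simp add: powr_r_rho powr_s_rho)
    finally show ?thesis .
  qed
  then show thesis using D C_pos by (intro that[of "D powr r * (C * D powr s)"]) auto
qed

text \<open>
  A cell is either too heavy for \<open>neighbour\<close> to apply, or its point can be exchanged for a point at
  distance \<open>gap * rho n\<close>; in the latter case optimality makes the cost, hence the mass of the cell,
  large.
\<close>

lemma optimal_cell_prob_lower:
  obtains \<eta> where "0 < \<eta>"
    "\<And>n \<alpha> P a. 1 \<le> n \<Longrightarrow> \<alpha> \<in> optimal_sets N n r \<mu> \<Longrightarrow> voronoi_partition N \<alpha> P \<Longrightarrow> a \<in> \<alpha>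
       \<Longrightarrow> \<eta> / n \<le> prob (P a)"
proof -
  obtain D where D: "0 < D" and cover: "\<And>n \<alpha> P x. 1 \<le> n \<Longrightarrow> \<alpha> \<in> optimal_sets N n r \<mu>
      \<Longrightarrow> voronoi_partition N \<alpha> P \<Longrightarrow> x \<in> supp \<mu> \<Longrightarrow> codist N \<alpha> x \<le> D * rho n"
    by (rule optimal_covering, rule that; blast)
  define \<eta> where "\<eta> = min (min 1 (c * D powr s)) (gain / (2 * D) powr r)"
  have \<eta>: "0 < \<eta>" using c_pos D gain_pos unfolding \<eta>_def by simp
  have "\<eta> / n \<le> prob (P a)"
    if n: "1 \<le> n" and \<alpha>: "\<alpha> \<in> optimal_sets N n r \<mu>" and P: "voronoi_partition N \<alpha> P"
      and a: "a \<in> \<alpha>" for n \<alpha> P a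
  proof (cases "prob (P a) < min 1 (c * (D * rho n) powr s)")
    case True
    note opt = optimal_setsD[OF \<alpha>]
    have Dn: "0 < D * rho n" using D rho_pos[OF n] by simp
    obtain x where x: "x \<in> supp \<mu>" "gap * rho n \<le> codist N \<alpha> x" by (rule gap_point[OF opt])
    have "gain * rho n powr r / n \<le> \<kappa> * (gap * rho n) powr r * prob (nball N x (gap * rho n / 4))"
      by (rule gain_le[OF x(1) n])
    also have "\<dots> \<le> (2 * (D * rho n)) powr r * prob (P a)"
      using gap_pos rho_pos[OF n] x(2) Dn neighbour[OF opt(1,2) P a Dn cover[OF n \<alpha> P] True]
      by (intro optimal_exchange[OF \<alpha> P a]) auto
    also have "\<dots> = rho n powr r * ((2 * D) powr r * prob (P a))"
      using D powr_r_rho[of "2 * D" n] by (simp add: mult_ac)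
    finally have "rho n powr r * (gain / n) \<le> rho n powr r * ((2 * D) powr r * prob (P a))"
      by (simp add: mult_ac)
    moreover have "0 < rho n powr r" using rho_pos[OF n] by simp
    ultimately have "gain / n \<le> (2 * D) powr r * prob (P a)" by (rule mult_left_le_imp_le)
    then have "gain / (2 * D) powr r / n \<le> prob (P a)" using D n by (simp add: field_simps)
    moreover have "\<eta> / n \<le> gain / (2 * D) powr r / n"
      unfolding \<eta>_def by (intro divide_right_mono) auto
    ultimately show ?thesis by simp
  next
    case False
    have "\<eta> / n \<le> min 1 (c * D powr s) / n"
      unfolding \<eta>_def by (intro divide_right_mono) auto
    also have "\<dots> \<le> min 1 (c * D powr s / n)"
      using n c_pos by (auto simp: min_def field_simps)
    also have "\<dots> \<le> prob (P a)" using leI[OF False] D n by (simp add: powr_s_rho)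
    finally show ?thesis .
  qed
  then show thesis using \<eta> that by blast
qed

text \<open>
  At radius \<open>t * rho n\<close> the ball around \<open>a\<close> contains at most half of the guaranteed mass of its
  cell; the remaining half is at distance more than \<open>t * rho n\<close> from \<open>a\<close>.
\<close>

lemma cell_error_lower:
  obtains b where "0 < b"
    "\<And>n \<alpha> P a. 1 \<le> n \<Longrightarrow> \<alpha> \<in> optimal_sets N n r \<mu> \<Longrightarrow> voronoi_partition N \<alpha> P \<Longrightarrow> a \<in> \<alpha>
       \<Longrightarrow> b * (rho n powr r / n) \<le> cell_error N r \<mu> \<alpha> P a"
proof -
  obtain \<eta> where \<eta>: "0 < \<eta>" and heavy: "\<And>n \<alpha> P a. 1 \<le> n \<Longrightarrow> \<alpha> \<in> optimal_sets N n r \<mu>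
      \<Longrightarrow> voronoi_partition N \<alpha> P \<Longrightarrow> a \<in> \<alpha> \<Longrightarrow> \<eta> / n \<le> prob (P a)"
    by (rule optimal_cell_prob_lower, rule that; blast)
  define t where "t = (\<eta> / (2 * C)) powr (1 / s)"
  have t: "0 < t" using \<eta> C_pos unfolding t_def by simp
  have t_s: "C * t powr s = \<eta> / 2"
    using \<eta> C_pos s_pos unfolding t_def by (simp add: powr_powr)
  have "(t powr r * (\<eta> / 2)) * (rho n powr r / n) \<le> cell_error N r \<mu> \<alpha> P a"
    if n: "1 \<le> n" and \<alpha>: "\<alpha> \<in> optimal_sets N n r \<mu>" and P: "voronoi_partition N \<alpha> P"
      and a: "a \<in> \<alpha>" for n \<alpha> P a
  proof -
    note opt = optimal_setsD[OF \<alpha>]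
    let ?B = "nball N a (t * rho n)"
    have B: "?B \<in> sets \<mu>" "P a \<in> sets \<mu>"
      using voronoiD(1)[OF P opt(1,2) a] by (simp_all add: sets_eq)
    have "prob ?B \<le> C * (t * rho n) powr s" using t rho_pos[OF n] by (intro ball_upper) auto
    also have "\<dots> = \<eta> / 2 / n" using t n t_s by (simp add: powr_s_rho field_simps)
    finally have "prob ?B \<le> \<eta> / 2 / n" .
    then have "\<eta> / 2 / n \<le> prob (P a) - prob ?B" using heavy[OF n \<alpha> P a] by simp
    also have "\<dots> \<le> prob (P a - ?B)"
      using B measure_Un_le[of "P a - ?B" \<mu> ?B] finite_measure_mono[of "P a" "P a - ?B \<union> ?B"] by fastforce
    finally have mass: "\<eta> / 2 / n \<le> prob (P a - ?B)" .
    have "(t powr r * (\<eta> / 2)) * (rho n powr r / n) = (t * rho n) powr r * (\<eta> / 2 / n)"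
      using t by (simp add: powr_r_rho)
    also have "\<dots> \<le> (t * rho n) powr r * prob (P a - ?B)"
      using mass by (intro mult_left_mono) auto
    also have "\<dots> = (\<integral>y. (t * rho n) powr r * indicator (P a - ?B) y \<partial>\<mu>)" by simp
    also have "\<dots> \<le> cell_error N r \<mu> \<alpha> P a"
      unfolding cell_error_eq(2)[OF opt(1,2) P a]
    proof (rule integral_mono[OF _ cell_error_eq(1)[OF opt(1,2) P a]])
      show "integrable \<mu> (\<lambda>y. (t * rho n) powr r * indicator (P a - ?B) y)"
        using B by (intro integrable_mult_right integrable_real_indicator) (auto simp: less_top[symmetric])
      show "(t * rho n) powr r * indicator (P a - ?B) y \<le> codist N \<alpha> y powr r * indicator (P a) y" for y
      proof (cases "y \<in> P a - ?B")
        case True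
        then have "t * rho n \<le> codist N \<alpha> y"
          using voronoiD(2)[OF P opt(1,2) a] by (simp add: nball_iff)
        then have "(t * rho n) powr r \<le> codist N \<alpha> y powr r"
          using t rho_pos[OF n] r_pos by (intro powr_mono2) auto
        then show ?thesis using True by simp
      qed simp
    qed
    finally show ?thesis .
  qed
  then show thesis using t \<eta> by (intro that[of "t powr r * (\<eta> / 2)"]) auto
qed

lemma V_optimal_decrement_lower:
  assumes n: "1 \<le> n" and \<alpha>: "\<alpha> \<in> optimal_sets N n r \<mu>" and \<beta>: "\<beta> \<in> optimal_sets N (n + 1) r \<mu>"
  shows "gain * (rho n powr r / n) \<le> V \<alpha> - V \<beta>"
proof -
  note opt = optimal_setsD[OF \<alpha>]
  obtain x where x: "V (insert x \<alpha>) \<le> V \<alpha> - gain * rho n powr r / n"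
    by (rule V_insert_gain[OF opt])
  have "V \<beta> \<le> V (insert x \<alpha>)"
    using opt by (intro optimal_V_le[OF \<beta>]) (auto simp: card_insert_if)
  then show ?thesis using x by simp
qed

text \<open>
  A point of an \<open>(n + 1)\<close>-optimal set whose cell has mass at most \<open>1 / (n + 1)\<close> can be deleted at
  small cost, and \<open>n\<close> points remain.
\<close>

lemma V_optimal_decrement_upper:
  obtains B where "0 < B"
    "\<And>n \<alpha> \<beta> P. 1 \<le> n \<Longrightarrow> \<alpha> \<in> optimal_sets N n r \<mu> \<Longrightarrow> \<beta> \<in> optimal_sets N (n + 1) r \<mu>
       \<Longrightarrow> voronoi_partition N \<beta> P \<Longrightarrow> V \<alpha> - V \<beta> \<le> B * (rho n powr r / n)"
proof -
  obtain D0 where D0: "0 < D0" and cover: "\<And>n \<alpha> P x. 1 \<le> n \<Longrightarrow> \<alpha> \<in> optimal_sets N n r \<mu>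
      \<Longrightarrow> voronoi_partition N \<alpha> P \<Longrightarrow> x \<in> supp \<mu> \<Longrightarrow> codist N \<alpha> x \<le> D0 * rho n"
    by (rule optimal_covering, rule that; blast)
  \<comment> \<open>Large enough that a cell of mass \<open>1 / (n + 1)\<close> is light at radius \<open>D * rho (n + 1)\<close>.\<close>
  define D where "D = max D0 ((2 / c) powr (1 / s))"
  have D: "0 < D" "D0 \<le> D" using D0 unfolding D_def by auto
  have "2 / c = ((2 / c) powr (1 / s)) powr s" using c_pos s_pos by (simp add: powr_powr)
  also have "\<dots> \<le> D powr s" unfolding D_def using s_pos by (intro powr_mono2) auto
  finally have D_s: "2 \<le> c * D powr s" using c_pos by (simp add: field_simps)
  have "V \<alpha> - V \<beta> \<le> (2 * D) powr r * (rho n powr r / n)"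
    if n: "1 \<le> n" and \<alpha>: "\<alpha> \<in> optimal_sets N n r \<mu>" and \<beta>: "\<beta> \<in> optimal_sets N (n + 1) r \<mu>"
      and P: "voronoi_partition N \<beta> P" for n \<alpha> \<beta> P
  proof -
    note opt = optimal_setsD[OF \<beta>]
    let ?t = "D * rho (n + 1)"
    have t: "0 < ?t" using D rho_pos[of "n + 1"] by simp
    have cov: "codist N \<beta> z \<le> ?t" if "z \<in> supp \<mu>" for z
    proof -
      have "codist N \<beta> z \<le> D0 * rho (n + 1)" using cover[OF _ \<beta> P that] by simp
      also have "\<dots> \<le> ?t" using D rho_pos[of "n + 1"] by (intro mult_right_mono) auto
      finally show ?thesis .
    qed
    obtain a where a: "a \<in> \<beta>" "prob (P a) \<le> 1 / (n + 1)"
      using light_cell[OF opt(1,2) P] card_optimal[OF \<beta>] by metis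
    have "1 / real (n + 1) < c * D powr s / real (n + 1)"
      using D_s by (intro divide_strict_right_mono) auto
    also have "\<dots> = c * ?t powr s" using D by (simp add: powr_s_rho)
    finally have light: "prob (P a) < min 1 (c * ?t powr s)" using a(2) n
      by (auto intro: le_less_trans)
    have card: "card (\<beta> - {a}) = n" using card_optimal[OF \<beta>] a(1) opt(1) by simp
    then have ne: "\<beta> - {a} \<noteq> {}" using n by (metis card.empty not_one_le_zero)
    have "V \<alpha> \<le> V (\<beta> - {a})"
      using opt card ne by (intro optimal_V_le[OF \<alpha>]) auto
    also have "\<dots> \<le> V \<beta> + (2 * ?t) powr r * prob (P a)"
      using neighbour[OF opt(1,2) P a(1) t cov light] t
      by (intro V_delete[OF opt(1) ne P a(1)]) auto
    finally have "V \<alpha> - V \<beta> \<le> (2 * ?t) powr r * prob (P a)" by simp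
    also have "\<dots> \<le> (2 * D * rho n) powr r * (1 / n)"
    proof (rule mult_mono)
      show "(2 * ?t) powr r \<le> (2 * D * rho n) powr r"
        using t D rho_antimono[OF n, of "n + 1"] r_pos by (intro powr_mono2) auto
      have "1 / real (n + 1) \<le> 1 / n" using n by (intro divide_left_mono) auto
      then show "prob (P a) \<le> 1 / n" using a(2) by simp
    qed auto
    also have "\<dots> = (2 * D) powr r * (rho n powr r / n)"
      using D powr_r_rho[of "2 * D" n] by simp
    finally show ?thesis .
  qed
  then show thesis using D by (intro that[of "(2 * D) powr r"]) auto
qed

end

section \<open>The three comparisons\<close>

lemma comparable_via:
  assumes x: "\<And>n. 1 \<le> n \<Longrightarrow> 0 < x n"
    and a: "0 < a1" "0 < a2" "\<And>n. 1 \<le> n \<Longrightarrow> a1 * x n \<le> a n" "\<And>n. 1 \<le> n \<Longrightarrow> a n \<le> a2 * x n"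
    and b: "0 < b1" "0 < b2" "\<And>n. 1 \<le> n \<Longrightarrow> b1 * x n \<le> b n" "\<And>n. 1 \<le> n \<Longrightarrow> b n \<le> b2 * x n"
  shows "comparable a b"
  unfolding comparable_def
proof (intro conjI allI impI exI)
  define K where "K = min (a1 / b2) (b1 / a2)"
  show K: "0 < K" using a b unfolding K_def by simp
  fix n :: nat assume n: "1 \<le> n"
  note xn = x[OF n] and an = a(3,4)[OF n] and bn = b(3,4)[OF n]
  show "0 < a n" using an(1) mult_pos_pos[OF a(1) xn] by linarith
  show "0 < b n" using bn(1) mult_pos_pos[OF b(1) xn] by linarith
  have "K * b n \<le> a1 / b2 * (b2 * x n)"
    using K bn \<open>0 < b n\<close> a b unfolding K_def by (intro mult_mono) auto
  also have "\<dots> \<le> a n" using an b(2) by simp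
  finally show "K * b n \<le> a n" .
  have "K * a n \<le> b1 / a2 * (a2 * x n)"
    using K an \<open>0 < a n\<close> a b unfolding K_def by (intro mult_mono) auto
  also have "\<dots> \<le> b n" using bn a(2) by simp
  finally show "a n \<le> inverse K * b n" using K by (simp add: field_simps)
qed

theorem theorem1p1:
  fixes N :: "real ^ 'q \<Rightarrow> real"
    and \<mu> :: "(real ^ 'q) measure"
    and s0 r :: real
    and \<alpha> :: "nat \<Rightarrow> (real ^ 'q) set"
    and P :: "nat \<Rightarrow> real ^ 'q \<Rightarrow> (real ^ 'q) set"
  assumes "is_norm N"
    and "borel_prob \<mu>"
    and "s0 > 0"
    and "ahlfors_david N s0 \<mu>"
    and "r > 0"
    and "\<And>n. n \<ge> 1 \<Longrightarrow> \<alpha> n \<in> optimal_sets N n r \<mu>"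
    and "\<And>n. n \<ge> 1 \<Longrightarrow> voronoi_partition N (\<alpha> n) (P n)"
  shows "comparable (\<lambda>n. J_lower N r \<mu> (\<alpha> n) (P n))
                    (\<lambda>n. 1 / real n * quant_error N n r \<mu> powr r) \<and>
         comparable (\<lambda>n. J_upper N r \<mu> (\<alpha> n) (P n))
                    (\<lambda>n. 1 / real n * quant_error N n r \<mu> powr r) \<and>
         comparable (\<lambda>n. quant_error N n r \<mu> powr r - quant_error N (n + 1) r \<mu> powr r)
                    (\<lambda>n. 1 / real n * quant_error N n r \<mu> powr r)"
proof -
  obtain c C R where "ahlfors_quantization N \<mu> s0 r c C R"
    using ahlfors_quantizationI assms(1-5) by metis
  then interpret ahlfors_quantization N \<mu> s0 r c C R .
  note opt = assms(6) and vor = assms(7)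
  \<comment> \<open>the common order of all four sequences\<close>
  define x where "x n = rho n powr r / n" for n :: nat
  have x: "0 < x n" if "1 \<le> n" for n
    using rho_pos[OF that] that unfolding x_def by simp
  note err = quant_error_powr[OF opt]

  obtain B where B: "0 < B" "\<And>n \<alpha> P. 1 \<le> n \<Longrightarrow> \<alpha> \<in> optimal_sets N n r \<mu>
      \<Longrightarrow> voronoi_partition N \<alpha> P \<Longrightarrow> V \<alpha> \<le> B * rho n powr r"
    by (rule V_optimal_upper, rule that; blast)
  obtain j where j: "0 < j" "\<And>n \<alpha> P a. 1 \<le> n \<Longrightarrow> \<alpha> \<in> optimal_sets N n r \<mu>
      \<Longrightarrow> voronoi_partition N \<alpha> P \<Longrightarrow> a \<in> \<alpha> \<Longrightarrow> j * (rho n powr r / n) \<le> cell_error N r \<mu> \<alpha> P a"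
    by (rule cell_error_lower, rule that; blast)
  obtain J where J: "0 < J" "\<And>n \<alpha> P a. 1 \<le> n \<Longrightarrow> \<alpha> \<in> optimal_sets N n r \<mu>
      \<Longrightarrow> voronoi_partition N \<alpha> P \<Longrightarrow> a \<in> \<alpha> \<Longrightarrow> cell_error N r \<mu> \<alpha> P a \<le> J * (rho n powr r / n)"
    by (rule cell_error_upper, rule that; blast)
  obtain E where E: "0 < E" "\<And>n \<alpha> \<beta> P. 1 \<le> n \<Longrightarrow> \<alpha> \<in> optimal_sets N n r \<mu>
      \<Longrightarrow> \<beta> \<in> optimal_sets N (n + 1) r \<mu> \<Longrightarrow> voronoi_partition N \<beta> P
      \<Longrightarrow> V \<alpha> - V \<beta> \<le> E * (rho n powr r / n)"
    by (rule V_optimal_decrement_upper, rule that; blast)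

  have fin: "finite (\<alpha> n)" "\<alpha> n \<noteq> {}" "card (\<alpha> n) \<le> n" if "1 \<le> n" for n
    using optimal_setsD[OF opt[OF that]] by auto
  have lower: "j * x n \<le> J_lower N r \<mu> (\<alpha> n) (P n)" if "1 \<le> n" for n
    using fin[OF that] j(2)[OF that opt[OF that] vor[OF that]] unfolding J_lower_def x_def by simp
  have upper: "J_upper N r \<mu> (\<alpha> n) (P n) \<le> J * x n" if "1 \<le> n" for n
    using fin[OF that] J(2)[OF that opt[OF that] vor[OF that]] unfolding J_upper_def x_def by simp
  have middle: "J_lower N r \<mu> (\<alpha> n) (P n) \<le> J_upper N r \<mu> (\<alpha> n) (P n)" if n: "1 \<le> n" for n
  proof -
    obtain a where "a \<in> \<alpha> n" using fin[OF n] by auto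
    then have "J_lower N r \<mu> (\<alpha> n) (P n) \<le> cell_error N r \<mu> (\<alpha> n) (P n) a"
      "cell_error N r \<mu> (\<alpha> n) (P n) a \<le> J_upper N r \<mu> (\<alpha> n) (P n)"
      using fin[OF n] unfolding J_lower_def J_upper_def by auto
    then show ?thesis by simp
  qed
  have err_lower: "gap powr r / 2 * x n \<le> 1 / real n * quant_error N n r \<mu> powr r" if "1 \<le> n" for n
    using divide_right_mono[OF V_lower[OF fin[OF that]], of "real n"] that by (simp add: err x_def)
  have err_upper: "1 / real n * quant_error N n r \<mu> powr r \<le> B * x n" if "1 \<le> n" for n
    using divide_right_mono[OF B(2)[OF that opt[OF that] vor[OF that]], of "real n"] that
    by (simp add: err x_def)
  have gap: "0 < gap powr r / 2" using gap_pos by simp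
  note cmp = comparable_via[of x, OF x _ _ _ _ gap B(1) err_lower err_upper]
  show ?thesis
  proof (intro conjI)
    show "comparable (\<lambda>n. J_lower N r \<mu> (\<alpha> n) (P n)) (\<lambda>n. 1 / real n * quant_error N n r \<mu> powr r)"
      using lower upper middle by (intro cmp[OF _ j(1) J(1)]) (auto intro: order_trans)
    show "comparable (\<lambda>n. J_upper N r \<mu> (\<alpha> n) (P n)) (\<lambda>n. 1 / real n * quant_error N n r \<mu> powr r)"
      using lower upper middle by (intro cmp[OF _ j(1) J(1)]) (auto intro: order_trans)
    show "comparable (\<lambda>n. quant_error N n r \<mu> powr r - quant_error N (n + 1) r \<mu> powr r)
        (\<lambda>n. 1 / real n * quant_error N n r \<mu> powr r)"
    proof (intro cmp[OF _ gain_pos E(1)])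
      fix n :: nat assume n: "1 \<le> n"
      then have n': "1 \<le> n + 1" by simp
      show "gain * x n \<le> quant_error N n r \<mu> powr r - quant_error N (n + 1) r \<mu> powr r"
        unfolding err[OF n] err[OF n'] x_def by (rule V_optimal_decrement_lower[OF n opt[OF n] opt[OF n']])
      show "quant_error N n r \<mu> powr r - quant_error N (n + 1) r \<mu> powr r \<le> E * x n"
        unfolding err[OF n] err[OF n'] x_def by (rule E(2)[OF n opt[OF n] opt[OF n'] vor[OF n']])
    qed auto
  qed
qed

end
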